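(* Let $\mathsf G\subseteq\mathbb R$ be a Borel set with Lebesgue measure $\nu$, let $\varpi:\mathsf G\to(0,\infty)$ and $\pi$ be as in the context, let $t_1\le t_2$ be in $(0,\|\varpi\|_\infty)$ and assume that $\varpi$ is $(t_1,t_2)$-bimodal. Let $h>0$ with $h\ge\Delta_\varpi$. Let $(H_t)$ be the stepping-out and shrinkage kernels with parameter $h$, $H$ the associated hybrid slice sampling kernel, and $U$ the ideal slice sampling kernel, all as defined in the context. Then for all $f\in\mathrm L^2_0(\pi)$, $$\rho\,\mathcal E_\pi(U,f)\le\mathcal E_\pi(H,f)\le\mathcal E_\pi(U,f),\qquad\text{where}\quad \rho:=\frac{h-\Delta_\varpi}{h}\cdot\frac{m_\varpi}{m_\varpi+\Delta_\varpi},$$ with the convention that $\frac{m_\varpi}{m_\varpi+\Delta_\varpi}=1$ if $m_\varpi=\infty$.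
   Context: Setting: $\mathsf G\subseteq\mathbb R$ with Borel $\sigma$-algebra, $\nu$ is the one-dimensional Lebesgue measure on $\mathsf G$; $\varpi:\mathsf G\to(0,\infty)$ is measurable with $c:=\int_{\mathsf G}\varpi\,\mathrm d\nu\in(0,\infty)$; $\pi(\mathrm dx)=c^{-1}\varpi(x)\,\nu(\mathrm dx)$. The supremum $\|\varpi\|_\infty$ is assumed to equal the $\nu$-essential supremum of $\varpi$. Let $\mathsf T=(0,\|\varpi\|_\infty)$ and for $t\in\mathsf T$: $\mathsf G(t)=\{x\in\mathsf G:\varpi(x)>t\}$, $\nu_t(A)=\nu(A\cap\mathsf G(t))/\nu(\mathsf G(t))$. Bimodality: $\varpi$ is $(t_1,t_2)$-bimodal if (a) for all $t\in\mathsf T\setminus[t_1,t_2)$ the set $\mathsf G(t)$ is a single interval, and (b) for all $t\in[t_1,t_2)$ the set $\mathsf G(t)$ is a disjoint union $\mathsf G(t)=\mathsf G_1(t)\sqcup\mathsf G_2(t)$ of two (nondegenerate) intervals such that $\mathsf G_i(t)\subseteq\mathsf G_i(s)$ for $i=1,2$ and $t_1\le s\le t<t_2$. For such $\varpi$ put $\delta_\varpi(t)=\inf\{|x-y|:x\in\mathsf G_1(t),y\in\mathsf G_2(t)\}$ for $t\in[t_1,t_2)$ and $\delta_\varpi(t)=0$ otherwise; $\Delta_\varpi=\sup_{t\in\mathsf T}\delta_\varpi(t)$; $m_\varpi=\inf\{\nu(\mathsf G(t)):t\in[t_1,t_2)\}$, with $\inf\emptyset=\infty$. Stepping-out and shrinkage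 kernels with parameter $h\ge\Delta_\varpi$: for $t\in\mathsf T\setminus[t_1,t_2)$, $H_t(x,\cdot)=\nu_t$; for $t\in[t_1,t_2)$, $x\in\mathsf G(t)$, $A\in\mathcal B(\mathsf G(t))$, $$H_t(x,A)=\lambda(t)\,\nu_t(A)+(1-\lambda(t))\left[\mathbf 1_{\mathsf G_1(t)}(x)\,\nu_{t,1}(A)+\mathbf 1_{\mathsf G_2(t)}(x)\,\nu_{t,2}(A)\right],$$ with $\lambda(t)=\frac{h-\delta_\varpi(t)}{h}\cdot\frac{\nu(\mathsf G(t))}{\nu(\mathsf G(t))+\delta_\varpi(t)}$ and $\nu_{t,i}(A)=\nu(\mathsf G_i(t)\cap A)/\nu(\mathsf G_i(t))$. Kernels: $U(x,A)=\frac1{\varpi(x)}\int_0^{\varpi(x)}\nu_t(A)\,\mathrm dt$ and $H(x,A)=\frac1{\varpi(x)}\int_0^{\varpi(x)}H_t(x,A\cap\mathsf G(t))\,\mathrm dt$. $\mathrm L^2_0(\pi)=\{f\in\mathrm L^2(\pi):\pi(f)=0\}$. The Dirichlet form of a $\pi$-reversible kernel $P$ is $\mathcal E_\pi(P,f)=\langle(\mathrm{Id}-\mathrm P)f,f\rangle_\pi=\frac12\iint[f(x)-f(y)]^2P(x,\mathrm dy)\pi(\mathrm dx)$. *)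

theory Defs
  imports "HOL-Probability.Probability"
begin

abbreviation nu :: "real set \<Rightarrow> real measure" where
  "nu G \<equiv> restrict_space lborel G"

definition norm_const :: "real set \<Rightarrow> (real \<Rightarrow> real) \<Rightarrow> ennreal" where
  "norm_const G w = (\<integral>\<^sup>+ x. ennreal (w x) \<partial>nu G)"

definition target :: "real set \<Rightarrow> (real \<Rightarrow> real) \<Rightarrow> real measure" where
  "target G w = density (nu G) (\<lambda>x. ennreal (w x) / norm_const G w)"

definition sup_on :: "real set \<Rightarrow> (real \<Rightarrow> real) \<Rightarrow> ereal" where
  "sup_on G w = (SUP x\<in>G. ereal (w x))"

definition levels :: "real set \<Rightarrow> (real \<Rightarrow> real) \<Rightarrow> real set" where
  "levels G w = {t. 0 < t \<and> ereal t < sup_on G w}"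

definition level_set :: "real set \<Rightarrow> (real \<Rightarrow> real) \<Rightarrow> real \<Rightarrow> real set" where
  "level_set G w t = {x \<in> G. w x > t}"

definition nondegenerate_interval :: "real set \<Rightarrow> bool" where
  "nondegenerate_interval I \<longleftrightarrow> is_interval I \<and> (\<exists>x\<in>I. \<exists>y\<in>I. x < y)"

text \<open>
  The families \<open>G1\<close>, \<open>G2\<close> of components are explicit parameters, because two touching
  intervals can be separated in more than one way. Their values outside \<open>{t1..<t2}\<close> are irrelevant.
\<close>

definition bimodal ::
  "real set \<Rightarrow> (real \<Rightarrow> real) \<Rightarrow> real \<Rightarrow> real \<Rightarrow> (real \<Rightarrow> real set) \<Rightarrow> (real \<Rightarrow> real set) \<Rightarrow> bool"
where
  "bimodal G w t1 t2 G1 G2 \<longleftrightarrow>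
     (\<forall>t \<in> levels G w - {t1..<t2}. is_interval (level_set G w t)) \<and>
     (\<forall>t \<in> {t1..<t2}.
        nondegenerate_interval (G1 t) \<and> nondegenerate_interval (G2 t) \<and>
        G1 t \<inter> G2 t = {} \<and> level_set G w t = G1 t \<union> G2 t) \<and>
     (\<forall>s t. t1 \<le> s \<longrightarrow> s \<le> t \<longrightarrow> t < t2 \<longrightarrow> G1 t \<subseteq> G1 s \<and> G2 t \<subseteq> G2 s)"

definition gap :: "real \<Rightarrow> real \<Rightarrow> (real \<Rightarrow> real set) \<Rightarrow> (real \<Rightarrow> real set) \<Rightarrow> real \<Rightarrow> real" where
  "gap t1 t2 G1 G2 t = (if t \<in> {t1..<t2} then setdist (G1 t) (G2 t) else 0)"

definition max_gap ::
  "real set \<Rightarrow> (real \<Rightarrow> real) \<Rightarrow> real \<Rightarrow> real \<Rightarrow> (real \<Rightarrow> real set) \<Rightarrow> (real \<Rightarrow> real set) \<Rightarrow> ereal"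
where
  "max_gap G w t1 t2 G1 G2 = (SUP t \<in> levels G w. ereal (gap t1 t2 G1 G2 t))"

definition min_mass :: "real set \<Rightarrow> (real \<Rightarrow> real) \<Rightarrow> real \<Rightarrow> real \<Rightarrow> ennreal" where
  "min_mass G w t1 t2 = (INF t \<in> {t1..<t2}. emeasure (nu G) (level_set G w t))"

definition step_weight ::
  "real set \<Rightarrow> (real \<Rightarrow> real) \<Rightarrow> real \<Rightarrow> real \<Rightarrow> (real \<Rightarrow> real set) \<Rightarrow> (real \<Rightarrow> real set) \<Rightarrow>
   real \<Rightarrow> real \<Rightarrow> real"
where
  "step_weight G w t1 t2 G1 G2 h t =
     (h - gap t1 t2 G1 G2 t) / h *
     (measure (nu G) (level_set G w t) /
       (measure (nu G) (level_set G w t) + gap t1 t2 G1 G2 t))"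

definition step_kernel ::
  "real set \<Rightarrow> (real \<Rightarrow> real) \<Rightarrow> real \<Rightarrow> real \<Rightarrow> (real \<Rightarrow> real set) \<Rightarrow> (real \<Rightarrow> real set) \<Rightarrow>
   real \<Rightarrow> real \<Rightarrow> real \<Rightarrow> real set \<Rightarrow> ennreal"
where
  "step_kernel G w t1 t2 G1 G2 h t x A =
     (if t \<in> {t1..<t2} then
        ennreal (step_weight G w t1 t2 G1 G2 h t) *
          emeasure (uniform_measure (nu G) (level_set G w t)) A +
        ennreal (1 - step_weight G w t1 t2 G1 G2 h t) *
          (indicator (G1 t) x * emeasure (uniform_measure (nu G) (G1 t)) A +
           indicator (G2 t) x * emeasure (uniform_measure (nu G) (G2 t)) A)
      else emeasure (uniform_measure (nu G) (level_set G w t)) A)"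

text \<open>
  Below, \<open>measure_of\<close> turns a set function into a measure. It would return the null measure for
  a set function that is not countably additive; for the two set functions used here, countable
  additivity follows from monotone convergence, since the integrands are measurable in \<open>t\<close>
  (the sets \<open>level_set G w t\<close>, \<open>G1 t\<close> and \<open>G2 t\<close> are decreasing in \<open>t\<close>).
\<close>

definition ideal_kernel :: "real set \<Rightarrow> (real \<Rightarrow> real) \<Rightarrow> real \<Rightarrow> real measure" where
  "ideal_kernel G w x = measure_of G (sets (nu G))
     (\<lambda>A. (\<integral>\<^sup>+ t \<in> {0<..<w x}. emeasure (uniform_measure (nu G) (level_set G w t)) A \<partial>lborel)
            / ennreal (w x))"

definition hybrid_kernel ::
  "real set \<Rightarrow> (real \<Rightarrow> real) \<Rightarrow> (real \<Rightarrow> real \<Rightarrow> real set \<Rightarrow> ennreal) \<Rightarrow> real \<Rightarrow> real measure"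
where
  "hybrid_kernel G w K x = measure_of G (sets (nu G))
     (\<lambda>A. (\<integral>\<^sup>+ t \<in> {0<..<w x}. K t x (A \<inter> level_set G w t) \<partial>lborel) / ennreal (w x))"

definition L2_0 :: "real measure \<Rightarrow> (real \<Rightarrow> real) set" where
  "L2_0 M = {f. f \<in> borel_measurable M \<and> integrable M (\<lambda>x. (f x)\<^sup>2) \<and> (\<integral>x. f x \<partial>M) = 0}"

definition dirichlet_form ::
  "real measure \<Rightarrow> (real \<Rightarrow> real measure) \<Rightarrow> (real \<Rightarrow> real) \<Rightarrow> real" where
  "dirichlet_form M P f = (\<integral>x. (f x - (\<integral>y. f y \<partial>P x)) * f x \<partial>M)"

end

theory Submission
  imports Defs
begin

text \<open>
  Both kernels act slice by slice: at level \<open>t\<close> a point of the slice \<open>L t = {w > t}\<close> is resampled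
  from a density \<open>Q t x y\<close> that is symmetric in \<open>x, y\<close>. By Fubini the Dirichlet form, multiplied by
  the normalising constant, is the integral over \<open>t\<close> of
  \<open>\<integral>\<^bsub>L t\<^esub> f\<^sup>2 - \<integral>\<integral> Q t x y f x f y\<close>. For the ideal kernel the integrand is
  \<open>V = E - a\<^sup>2 / \<nu>(L t)\<close> with \<open>E = \<integral>\<^bsub>L t\<^esub> f\<^sup>2\<close> and \<open>a = \<integral>\<^bsub>L t\<^esub> f\<close>; for the hybrid kernel it is
  \<open>\<lambda> V + (1 - \<lambda>) (E - a\<^sub>1\<^sup>2 / \<nu>(G\<^sub>1 t) - a\<^sub>2\<^sup>2 / \<nu>(G\<^sub>2 t))\<close>, where \<open>\<lambda>\<close> is the step weight and \<open>a\<^sub>i\<close> is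
  the integral of \<open>f\<close> over \<open>G\<^sub>i t\<close>. The last bracket is nonnegative by Cauchy-Schwarz on each
  component and at most \<open>V\<close> because \<open>(a\<^sub>1 + a\<^sub>2)\<^sup>2 / (p + q) \<le> a\<^sub>1\<^sup>2 / p + a\<^sub>2\<^sup>2 / q\<close>. So the hybrid
  integrand lies between \<open>\<lambda> V\<close> and \<open>V\<close>, and \<open>\<lambda>\<close> is at least \<open>\<rho>\<close>.
\<close>

section \<open>Dirichlet forms of kernels mixed over levels\<close>

text \<open>\<open>Q t x y / w x\<close> is the joint density of level and new point: by
  \<open>Q_mass\<close> the mass in \<open>y\<close> is 1 exactly at levels
  \<open>0 < t < w x\<close>, hence \<open>w x\<close> over all levels. Symmetry at each level gives
  reversibility.\<close>

locale layered_kernel = sigma_finite_measure M for M :: "real measure" +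
  fixes w :: "real \<Rightarrow> real" and Q :: "real \<Rightarrow> real \<Rightarrow> real \<Rightarrow> real"
  assumes w_measurable [measurable]: "w \<in> borel_measurable M"
    and w_pos: "x \<in> space M \<Longrightarrow> 0 < w x"
    and Q_measurable:
      "(\<lambda>p. Q (fst p) (fst (snd p)) (snd (snd p))) \<in> borel_measurable (lborel \<Otimes>\<^sub>M (M \<Otimes>\<^sub>M M))"
    and Q_nonneg: "0 \<le> Q t x y"
    and Q_sym: "Q t x y = Q t y x"
    and Q_mass: "x \<in> space M \<Longrightarrow> (\<integral>\<^sup>+ y. ennreal (Q t x y) \<partial>M) = indicator {0<..<w x} t"
begin

sublocale lborel_M: pair_sigma_finite lborel M
  by (simp add: pair_sigma_finite_def lborel.sigma_finite_measure_axioms sigma_finite_measure_axioms)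

sublocale M_M: pair_sigma_finite M M
  by (simp add: pair_sigma_finite_def sigma_finite_measure_axioms)

lemma Q_measurable_raw [measurable (raw)]:
  assumes [measurable]: "a \<in> measurable N lborel" "b \<in> measurable N M" "c \<in> measurable N M"
  shows "(\<lambda>p. Q (a p) (b p) (c p)) \<in> borel_measurable N"
proof -
  have "(\<lambda>p. (a p, b p, c p)) \<in> measurable N (lborel \<Otimes>\<^sub>M (M \<Otimes>\<^sub>M M))"
    by measurable
  from measurable_compose[OF this Q_measurable] show ?thesis by simp
qed

lemma indicator_below_measurable [measurable (raw)]:
  assumes [measurable]: "a \<in> borel_measurable N" "b \<in> measurable N M"
  shows "(\<lambda>p. indicat_real {0<..<w (b p)} (a p)) \<in> borel_measurable N"
  unfolding indicator_def greaterThanLessThan_iff by measurable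

text \<open>
  The distribution of the second component of \<open>(t, y)\<close> with density \<open>Q t x y / w x\<close>. Keeping \<open>t\<close> as a
  coordinate avoids a density in \<open>y\<close> alone, which may be infinite.
\<close>

definition kernel :: "real \<Rightarrow> real measure" where
  "kernel x = distr (density (lborel \<Otimes>\<^sub>M M) (\<lambda>p. ennreal (Q (fst p) x (snd p) / w x))) M snd"

lemma space_kernel [simp]: "space (kernel x) = space M"
  and sets_kernel [simp]: "sets (kernel x) = sets M"
  by (simp_all add: kernel_def)

lemma emeasure_kernel:
  assumes x: "x \<in> space M" and A [measurable]: "A \<in> sets M"
  shows "emeasure (kernel x) A = (\<integral>\<^sup>+ t. (\<integral>\<^sup>+ y. ennreal (Q t x y) * indicator A y \<partial>M) \<partial>lborel) / ennreal (w x)"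
proof -
  note [measurable] = x
  have "emeasure (kernel x) A =
      (\<integral>\<^sup>+ p. ennreal (Q (fst p) x (snd p) / w x) * indicator (snd -` A \<inter> space (lborel \<Otimes>\<^sub>M M)) p \<partial>(lborel \<Otimes>\<^sub>M M))"
    unfolding kernel_def by (subst emeasure_distr, simp_all, subst emeasure_density) measurable
  also have "\<dots> = (\<integral>\<^sup>+ p. (ennreal (Q (fst p) x (snd p)) * indicator A (snd p)) / ennreal (w x) \<partial>(lborel \<Otimes>\<^sub>M M))"
    by (intro nn_integral_cong)
       (auto simp: divide_ennreal[symmetric] Q_nonneg w_pos[OF x] indicator_def)
  also have "\<dots> = (\<integral>\<^sup>+ p. (ennreal (Q (fst p) x (snd p)) * indicator A (snd p)) \<partial>(lborel \<Otimes>\<^sub>M M)) / ennreal (w x)"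
    by (rule nn_integral_divide) measurable
  also have "(\<integral>\<^sup>+ p. (ennreal (Q (fst p) x (snd p)) * indicator A (snd p)) \<partial>(lborel \<Otimes>\<^sub>M M)) =
     (\<integral>\<^sup>+ t. (\<integral>\<^sup>+ y. ennreal (Q t x y) * indicator A y \<partial>M) \<partial>lborel)"
    by (subst nn_integral_fst[symmetric]) measurable
  finally show ?thesis .
qed

text \<open>\<open>measure_of\<close> depends only on the values on \<open>sets M\<close>, and these
  agree with \<open>kernel x\<close>, a measure by construction. Countable additivity of
  \<open>\<mu>\<close> is thereby inherited.\<close>

lemma kernel_eqI:
  assumes x: "x \<in> space M"
    and "\<And>A. A \<in> sets M \<Longrightarrow> \<mu> A = (\<integral>\<^sup>+ t. (\<integral>\<^sup>+ y. ennreal (Q t x y) * indicator A y \<partial>M) \<partial>lborel) / ennreal (w x)"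
  shows "measure_of (space M) (sets M) \<mu> = kernel x"
proof -
  have "measure_of (space M) (sets M) \<mu> = measure_of (space M) (sets M) (emeasure (kernel x))"
    by (intro measure_of_eq sets.space_closed) (simp add: assms emeasure_kernel sets.sigma_sets_eq)
  also have "\<dots> = kernel x"
    using measure_of_of_measure[of "kernel x"] by simp
  finally show ?thesis .
qed

text \<open>Holds for every measurable \<open>f\<close>: \<open>distr\<close>,
  \<open>density\<close> and scaling by \<open>w x\<close> also respect the default value 0 of a
  nonintegrable integrand.\<close>

lemma integral_kernel:
  assumes x: "x \<in> space M" and f [measurable]: "f \<in> borel_measurable M"
  shows "(\<integral>y. f y \<partial>kernel x) = (\<integral>p. Q (fst p) x (snd p) * f (snd p) \<partial>(lborel \<Otimes>\<^sub>M M)) / w x"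
proof -
  note [measurable] = x
  have "(\<integral>y. f y \<partial>kernel x) = (\<integral>p. f (snd p) \<partial>density (lborel \<Otimes>\<^sub>M M) (\<lambda>p. ennreal (Q (fst p) x (snd p) / w x)))"
    unfolding kernel_def by (subst integral_distr) simp_all
  also have "\<dots> = (\<integral>p. Q (fst p) x (snd p) / w x * f (snd p) \<partial>(lborel \<Otimes>\<^sub>M M))"
    by (subst integral_density) (measurable, simp_all add: Q_nonneg w_pos[OF x] less_imp_le)
  also have "\<dots> = (\<integral>p. (Q (fst p) x (snd p) * f (snd p)) / w x \<partial>(lborel \<Otimes>\<^sub>M M))"
    by (intro Bochner_Integration.integral_cong) simp_all
  also have "\<dots> = (\<integral>p. Q (fst p) x (snd p) * f (snd p) \<partial>(lborel \<Otimes>\<^sub>M M)) / w x"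
    by (rule integral_divide_zero)
  finally show ?thesis .
qed

section \<open>Invariance and integrability of the cross term\<close>

lemma nn_integral_Q_left:
  assumes [measurable]: "g \<in> borel_measurable M"
  shows "(\<integral>\<^sup>+ x. (\<integral>\<^sup>+ t. (\<integral>\<^sup>+ y. ennreal (Q t x y) * g x \<partial>M) \<partial>lborel) \<partial>M) = (\<integral>\<^sup>+ x. ennreal (w x) * g x \<partial>M)"
proof (intro nn_integral_cong)
  fix x assume x [measurable]: "x \<in> space M"
  have "(\<integral>\<^sup>+ t. (\<integral>\<^sup>+ y. ennreal (Q t x y) * g x \<partial>M) \<partial>lborel) = (\<integral>\<^sup>+ t. indicator {0<..<w x} t * g x \<partial>lborel)"
    by (simp add: nn_integral_multc Q_mass[OF x])
  also have "\<dots> = ennreal (w x) * g x"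
    using w_pos[OF x] by (simp add: nn_integral_multc)
  finally show "(\<integral>\<^sup>+ t. (\<integral>\<^sup>+ y. ennreal (Q t x y) * g x \<partial>M) \<partial>lborel) = ennreal (w x) * g x" .
qed

text \<open>Invariance of the measure with density \<open>w\<close>: Tonelli makes \<open>x\<close>
  the innermost variable, and symmetry of \<open>Q\<close> then exchanges \<open>x\<close> and
  \<open>y\<close>, which leads back to \<open>nn_integral_Q_left\<close>.\<close>

lemma nn_integral_Q_right:
  assumes [measurable]: "g \<in> borel_measurable M"
  shows "(\<integral>\<^sup>+ x. (\<integral>\<^sup>+ t. (\<integral>\<^sup>+ y. ennreal (Q t x y) * g y \<partial>M) \<partial>lborel) \<partial>M) = (\<integral>\<^sup>+ x. ennreal (w x) * g x \<partial>M)"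
proof -
  have "(\<integral>\<^sup>+ x. (\<integral>\<^sup>+ t. (\<integral>\<^sup>+ y. ennreal (Q t x y) * g y \<partial>M) \<partial>lborel) \<partial>M)
      = (\<integral>\<^sup>+ t. (\<integral>\<^sup>+ x. (\<integral>\<^sup>+ y. ennreal (Q t x y) * g y \<partial>M) \<partial>M) \<partial>lborel)"
    by (rule lborel_M.Fubini') measurable
  also have "\<dots> = (\<integral>\<^sup>+ t. (\<integral>\<^sup>+ y. (\<integral>\<^sup>+ x. ennreal (Q t x y) * g y \<partial>M) \<partial>M) \<partial>lborel)"
    by (intro nn_integral_cong M_M.Fubini') measurable
  also have "\<dots> = (\<integral>\<^sup>+ y. (\<integral>\<^sup>+ t. (\<integral>\<^sup>+ x. ennreal (Q t x y) * g y \<partial>M) \<partial>lborel) \<partial>M)"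
    by (rule lborel_M.Fubini'[symmetric]) measurable
  also have "\<dots> = (\<integral>\<^sup>+ y. (\<integral>\<^sup>+ t. (\<integral>\<^sup>+ x. ennreal (Q t y x) * g y \<partial>M) \<partial>lborel) \<partial>M)"
    by (subst Q_sym) simp
  also have "\<dots> = (\<integral>\<^sup>+ x. ennreal (w x) * g x \<partial>M)"
    by (rule nn_integral_Q_left) fact
  finally show ?thesis .
qed

context
  fixes f :: "real \<Rightarrow> real"
  assumes f_measurable [measurable]: "f \<in> borel_measurable M"
    and f_L2: "integrable M (\<lambda>x. w x * (f x)\<^sup>2)"
begin

text \<open>The product \<open>f x * f y\<close> is dominated by the sum of the squares, and against
  \<open>Q\<close> each square integrates to the integral of \<open>w * f^2\<close> by the two
  preceding identities.\<close>

lemma nn_integral_cross_finite: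
  "(\<integral>\<^sup>+ x. (\<integral>\<^sup>+ t. (\<integral>\<^sup>+ y. ennreal \<bar>Q t x y * f x * f y\<bar> \<partial>M) \<partial>lborel) \<partial>M) < \<infinity>"
proof -
  let ?g = "\<lambda>x. ennreal ((f x)\<^sup>2)"
  have AMGM: "ennreal \<bar>Q t x y * f x * f y\<bar> \<le> ennreal (Q t x y) * ?g x + ennreal (Q t x y) * ?g y" for t x y
  proof -
    have "2 * (\<bar>f x\<bar> * \<bar>f y\<bar>) \<le> (f x)\<^sup>2 + (f y)\<^sup>2"
      using sum_squares_bound[of "\<bar>f x\<bar>" "\<bar>f y\<bar>"] by simp
    then have "\<bar>f x * f y\<bar> \<le> (f x)\<^sup>2 + (f y)\<^sup>2"
      using mult_nonneg_nonneg[of "\<bar>f x\<bar>" "\<bar>f y\<bar>"] by (simp add: abs_mult del: mult_nonneg_nonneg)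
    from mult_left_mono[OF this Q_nonneg[of t x y]]
    have "\<bar>Q t x y * f x * f y\<bar> \<le> Q t x y * (f x)\<^sup>2 + Q t x y * (f y)\<^sup>2"
      by (simp add: abs_mult Q_nonneg algebra_simps)
    then have "ennreal \<bar>Q t x y * f x * f y\<bar> \<le> ennreal (Q t x y * (f x)\<^sup>2 + Q t x y * (f y)\<^sup>2)"
      by (rule ennreal_leI)
    then show ?thesis
      by (simp add: Q_nonneg ennreal_mult)
  qed
  have fin: "(\<integral>\<^sup>+ x. ennreal (w x) * ?g x \<partial>M) < \<infinity>"
  proof -
    have "(\<integral>\<^sup>+ x. ennreal (w x) * ?g x \<partial>M) = (\<integral>\<^sup>+ x. ennreal (norm (w x * (f x)\<^sup>2)) \<partial>M)"
      using w_pos by (intro nn_integral_cong) (simp add: ennreal_mult[symmetric] less_imp_le abs_mult)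
    also have "\<dots> < \<infinity>" using f_L2 unfolding integrable_iff_bounded by simp
    finally show ?thesis .
  qed
  have "(\<integral>\<^sup>+ x. (\<integral>\<^sup>+ t. (\<integral>\<^sup>+ y. ennreal \<bar>Q t x y * f x * f y\<bar> \<partial>M) \<partial>lborel) \<partial>M)
     \<le> (\<integral>\<^sup>+ x. (\<integral>\<^sup>+ t. (\<integral>\<^sup>+ y. ennreal (Q t x y) * ?g x + ennreal (Q t x y) * ?g y \<partial>M) \<partial>lborel) \<partial>M)"
    by (intro nn_integral_mono AMGM)
  also have "\<dots> = (\<integral>\<^sup>+ x. (\<integral>\<^sup>+ t. (\<integral>\<^sup>+ y. ennreal (Q t x y) * ?g x \<partial>M) + (\<integral>\<^sup>+ y. ennreal (Q t x y) * ?g y \<partial>M) \<partial>lborel) \<partial>M)"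
    by (intro nn_integral_cong nn_integral_add) measurable
  also have "\<dots> = (\<integral>\<^sup>+ x. (\<integral>\<^sup>+ t. (\<integral>\<^sup>+ y. ennreal (Q t x y) * ?g x \<partial>M) \<partial>lborel) + (\<integral>\<^sup>+ t. (\<integral>\<^sup>+ y. ennreal (Q t x y) * ?g y \<partial>M) \<partial>lborel) \<partial>M)"
    by (intro nn_integral_cong nn_integral_add) measurable
  also have "\<dots> = (\<integral>\<^sup>+ x. (\<integral>\<^sup>+ t. (\<integral>\<^sup>+ y. ennreal (Q t x y) * ?g x \<partial>M) \<partial>lborel) \<partial>M) + (\<integral>\<^sup>+ x. (\<integral>\<^sup>+ t. (\<integral>\<^sup>+ y. ennreal (Q t x y) * ?g y \<partial>M) \<partial>lborel) \<partial>M)"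
    by (intro nn_integral_add) measurable
  also have "\<dots> < \<infinity>"
    using fin by (simp add: nn_integral_Q_left nn_integral_Q_right)
  finally show ?thesis .
qed

text \<open>The same function is used under two groupings of the variables. With \<open>x\<close>
  outermost it matches the integral of \<open>f\<close> against \<open>kernel x\<close>; with
  \<open>(t, x)\<close> outermost, as in the next lemma, it matches the double integral over one
  slice.\<close>

lemma integrable_cross_x_ty:
  "integrable (M \<Otimes>\<^sub>M (lborel \<Otimes>\<^sub>M M)) (\<lambda>(x, t, y). Q t x y * f x * f y)"
proof (rule integrableI_bounded)
  have "(\<integral>\<^sup>+ p. ennreal (norm (case p of (x, t, y) \<Rightarrow> Q t x y * f x * f y)) \<partial>(M \<Otimes>\<^sub>M (lborel \<Otimes>\<^sub>M M)))
      = (\<integral>\<^sup>+ x. (\<integral>\<^sup>+ p. ennreal \<bar>Q (fst p) x (snd p) * f x * f (snd p)\<bar> \<partial>(lborel \<Otimes>\<^sub>M M)) \<partial>M)"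
    by (subst lborel_M.P.nn_integral_fst[symmetric]) (measurable, simp add: split_beta')
  also have "\<dots> = (\<integral>\<^sup>+ x. (\<integral>\<^sup>+ t. (\<integral>\<^sup>+ y. ennreal \<bar>Q t x y * f x * f y\<bar> \<partial>M) \<partial>lborel) \<partial>M)"
  proof (intro nn_integral_cong)
    fix x assume x [measurable]: "x \<in> space M"
    show "(\<integral>\<^sup>+ p. ennreal \<bar>Q (fst p) x (snd p) * f x * f (snd p)\<bar> \<partial>(lborel \<Otimes>\<^sub>M M))
      = (\<integral>\<^sup>+ t. (\<integral>\<^sup>+ y. ennreal \<bar>Q t x y * f x * f y\<bar> \<partial>M) \<partial>lborel)"
      by (subst nn_integral_fst[symmetric]) measurable
  qed
  finally show "(\<integral>\<^sup>+ p. ennreal (norm (case p of (x, t, y) \<Rightarrow> Q t x y * f x * f y)) \<partial>(M \<Otimes>\<^sub>M (lborel \<Otimes>\<^sub>M M))) < \<infinity>"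
    using nn_integral_cross_finite by simp
qed measurable

lemma integrable_cross_tx_y:
  "integrable ((lborel \<Otimes>\<^sub>M M) \<Otimes>\<^sub>M M) (\<lambda>p. Q (fst (fst p)) (snd (fst p)) (snd p) * f (snd (fst p)) * f (snd p))"
proof (rule integrableI_bounded)
  have "(\<integral>\<^sup>+ p. ennreal (norm (Q (fst (fst p)) (snd (fst p)) (snd p) * f (snd (fst p)) * f (snd p))) \<partial>((lborel \<Otimes>\<^sub>M M) \<Otimes>\<^sub>M M))
      = (\<integral>\<^sup>+ p. (\<integral>\<^sup>+ y. ennreal \<bar>Q (fst p) (snd p) y * f (snd p) * f y\<bar> \<partial>M) \<partial>(lborel \<Otimes>\<^sub>M M))"
    by (subst nn_integral_fst[symmetric]) measurable
  also have "\<dots> = (\<integral>\<^sup>+ t. (\<integral>\<^sup>+ x. (\<integral>\<^sup>+ y. ennreal \<bar>Q t x y * f x * f y\<bar> \<partial>M) \<partial>M) \<partial>lborel)"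
    by (subst nn_integral_fst[symmetric]) measurable
  also have "\<dots> = (\<integral>\<^sup>+ x. (\<integral>\<^sup>+ t. (\<integral>\<^sup>+ y. ennreal \<bar>Q t x y * f x * f y\<bar> \<partial>M) \<partial>lborel) \<partial>M)"
    by (rule lborel_M.Fubini'[symmetric]) measurable
  finally show "(\<integral>\<^sup>+ p. ennreal (norm (Q (fst (fst p)) (snd (fst p)) (snd p) * f (snd (fst p)) * f (snd p))) \<partial>((lborel \<Otimes>\<^sub>M M) \<Otimes>\<^sub>M M)) < \<infinity>"
    using nn_integral_cross_finite by simp
qed measurable

text \<open>Layer cake: the levels between 0 and \<open>w x\<close> form an interval of length
  \<open>w x\<close>, so the total integral is that of \<open>w * f^2\<close>.\<close>

lemma integrable_square_tx:
  "integrable (lborel \<Otimes>\<^sub>M M) (\<lambda>(t, x). indicat_real {0<..<w x} t * (f x)\<^sup>2)"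
proof (rule integrableI_bounded)
  have "(\<integral>\<^sup>+ p. ennreal (norm (case p of (t, x) \<Rightarrow> indicat_real {0<..<w x} t * (f x)\<^sup>2)) \<partial>(lborel \<Otimes>\<^sub>M M))
      = (\<integral>\<^sup>+ x. (\<integral>\<^sup>+ t. ennreal ((f x)\<^sup>2) * indicator {0<..<w x} t \<partial>lborel) \<partial>M)"
    by (subst lborel_M.nn_integral_snd[symmetric])
       (measurable, intro nn_integral_cong, simp add: indicator_def)
  also have "\<dots> = (\<integral>\<^sup>+ x. ennreal (norm (w x * (f x)\<^sup>2)) \<partial>M)"
    using w_pos by (intro nn_integral_cong)
      (subst nn_integral_cmult_indicator, auto simp: ennreal_mult less_imp_le abs_mult mult.commute)
  also have "\<dots> < \<infinity>" using f_L2 unfolding integrable_iff_bounded by simp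
  finally show "(\<integral>\<^sup>+ p. ennreal (norm (case p of (t, x) \<Rightarrow> indicat_real {0<..<w x} t * (f x)\<^sup>2)) \<partial>(lborel \<Otimes>\<^sub>M M)) < \<infinity>" .
qed measurable

section \<open>Dirichlet form as an integral over levels\<close>

definition layer_form :: "real \<Rightarrow> real" where
  "layer_form t = (\<integral>x. indicat_real {0<..<w x} t * (f x)\<^sup>2 \<partial>M) - (\<integral>x. (\<integral>y. Q t x y * f x * f y \<partial>M) \<partial>M)"

text \<open>Supplies the levels at which the slicewise estimates are proved. At the remaining null
  set of levels the integrals in \<open>layer_form\<close> may take the default value 0.\<close>

lemma AE_integrable_square: "AE t in lborel. integrable M (\<lambda>x. indicat_real {0<..<w x} t * (f x)\<^sup>2)"
  using lborel_M.AE_integrable_fst[OF integrable_square_tx] .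

lemma integrable_layer_form: "integrable lborel layer_form"
proof -
  interpret LMM: pair_sigma_finite "lborel \<Otimes>\<^sub>M M" M
    by (simp add: pair_sigma_finite_def lborel_M.P.sigma_finite_measure_axioms sigma_finite_measure_axioms)
  have "integrable (lborel \<Otimes>\<^sub>M M) (\<lambda>(t, x). \<integral>y. Q t x y * f x * f y \<partial>M)"
    using LMM.integrable_fst'[OF integrable_cross_tx_y] by (simp add: split_beta')
  from lborel_M.integrable_fst[OF this] lborel_M.integrable_fst[OF integrable_square_tx]
  show ?thesis unfolding layer_form_def[abs_def] by (intro Bochner_Integration.integrable_diff)
qed

text \<open>The density \<open>w x\<close> cancels the normalisation \<open>1 / w x\<close> of
  \<open>kernel x\<close>. Writing \<open>w x\<close> in the square term as the length of
  \<open>{0<..<w x}\<close>, Fubini moves the level outermost in both terms.\<close>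

lemma dirichlet_form_kernel:
  assumes c: "0 < c"
  shows "dirichlet_form (density M (\<lambda>x. ennreal (w x / c))) kernel f = (\<integral>t. layer_form t \<partial>lborel) / c"
proof -
  interpret LMM: pair_sigma_finite "lborel \<Otimes>\<^sub>M M" M
    by (simp add: pair_sigma_finite_def lborel_M.P.sigma_finite_measure_axioms sigma_finite_measure_axioms)
  interpret MLM: pair_sigma_finite M "lborel \<Otimes>\<^sub>M M"
    by (simp add: pair_sigma_finite_def lborel_M.P.sigma_finite_measure_axioms sigma_finite_measure_axioms)
  let ?C = "\<lambda>x. \<integral>p. Q (fst p) x (snd p) * f x * f (snd p) \<partial>(lborel \<Otimes>\<^sub>M M)"
  have int_C: "integrable M ?C"
    using MLM.integrable_fst'[OF integrable_cross_x_ty] by (simp add: split_beta')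
  have int_y: "integrable (lborel \<Otimes>\<^sub>M M) (\<lambda>(t, x). \<integral>y. Q t x y * f x * f y \<partial>M)"
    using LMM.integrable_fst'[OF integrable_cross_tx_y] by (simp add: split_beta')
  have inner [measurable]: "(\<lambda>x. \<integral>y. f y \<partial>kernel x) \<in> borel_measurable M"
  proof -
    have "(\<lambda>x. (\<integral>p. Q (fst p) x (snd p) * f (snd p) \<partial>(lborel \<Otimes>\<^sub>M M)) / w x) \<in> borel_measurable M"
      by measurable
    then show ?thesis
      by (rule measurable_cong[THEN iffD1, rotated]) (simp add: integral_kernel)
  qed
  have "dirichlet_form (density M (\<lambda>x. ennreal (w x / c))) kernel f
      = (\<integral>x. w x / c * ((f x - (\<integral>y. f y \<partial>kernel x)) * f x) \<partial>M)"
    unfolding dirichlet_form_def using c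
    by (subst integral_density) (measurable, auto intro!: AE_I2 simp: w_pos less_imp_le)
  also have "\<dots> = (\<integral>x. (w x * (f x)\<^sup>2 - ?C x) / c \<partial>M)"
  proof (intro Bochner_Integration.integral_cong refl)
    fix x assume x: "x \<in> space M"
    have "?C x = (\<integral>p. f x * (Q (fst p) x (snd p) * f (snd p)) \<partial>(lborel \<Otimes>\<^sub>M M))"
      by (intro Bochner_Integration.integral_cong) auto
    then have "?C x = f x * (w x * (\<integral>y. f y \<partial>kernel x))"
      using w_pos[OF x] by (simp add: integral_kernel[OF x])
    then show "w x / c * ((f x - (\<integral>y. f y \<partial>kernel x)) * f x) = (w x * (f x)\<^sup>2 - ?C x) / c"
      by (simp add: power2_eq_square algebra_simps diff_divide_distrib)
  qed
  also have "\<dots> = ((\<integral>x. w x * (f x)\<^sup>2 \<partial>M) - (\<integral>x. ?C x \<partial>M)) / c"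
    by (simp add: Bochner_Integration.integral_diff[OF f_L2 int_C])
  also have "(\<integral>x. w x * (f x)\<^sup>2 \<partial>M) = (\<integral>x. (\<integral>t. indicat_real {0<..<w x} t * (f x)\<^sup>2 \<partial>lborel) \<partial>M)"
    by (intro Bochner_Integration.integral_cong) (auto simp: w_pos less_imp_le)
  also have "\<dots> = (\<integral>t. (\<integral>x. indicat_real {0<..<w x} t * (f x)\<^sup>2 \<partial>M) \<partial>lborel)"
    by (rule lborel_M.Fubini_integral[OF integrable_square_tx])
  \<comment> \<open>Integrability of the section in \<open>(t, y)\<close> is known only for almost
    every \<open>x\<close>, so the planar integral is iterated only almost everywhere.\<close>
  also have "(\<integral>x. ?C x \<partial>M) = (\<integral>x. (\<integral>t. (\<integral>y. Q t x y * f x * f y \<partial>M) \<partial>lborel) \<partial>M)"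
  proof (rule integral_cong_AE)
    show "AE x in M. ?C x = (\<integral>t. (\<integral>y. Q t x y * f x * f y \<partial>M) \<partial>lborel)"
      using MLM.AE_integrable_fst'[OF integrable_cross_x_ty]
    proof eventually_elim
      case (elim x)
      then show ?case
        using lborel_M.integral_fst[of "\<lambda>t y. Q t x y * f x * f y"] by (simp add: split_beta')
    qed
  qed measurable
  also have "\<dots> = (\<integral>t. (\<integral>x. (\<integral>y. Q t x y * f x * f y \<partial>M) \<partial>M) \<partial>lborel)"
    by (rule lborel_M.Fubini_integral[OF int_y])
  also have "(\<integral>t. (\<integral>x. indicat_real {0<..<w x} t * (f x)\<^sup>2 \<partial>M) \<partial>lborel)
      - (\<integral>t. (\<integral>x. (\<integral>y. Q t x y * f x * f y \<partial>M) \<partial>M) \<partial>lborel) = (\<integral>t. layer_form t \<partial>lborel)"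
    unfolding layer_form_def
    by (rule Bochner_Integration.integral_diff[symmetric])
       (intro lborel_M.integrable_fst[OF integrable_square_tx] lborel_M.integrable_fst[OF int_y])+
  finally show ?thesis .
qed

end

end

section \<open>Slices split into two parts\<close>

text \<open>The difference of the two sides is a square over a positive denominator. Later
  \<open>p\<close>, \<open>q\<close> are the masses of the parts of a slice and \<open>a\<close>,
  \<open>b\<close> the integrals of \<open>f\<close> over them.\<close>

lemma sum_square_divide_le:
  fixes a b p q :: real
  assumes "0 < p" "0 < q"
  shows "(a + b)\<^sup>2 / (p + q) \<le> a\<^sup>2 / p + b\<^sup>2 / q"
proof -
  have "a\<^sup>2 / p + b\<^sup>2 / q - (a + b)\<^sup>2 / (p + q) = (a * q - b * p)\<^sup>2 / (p * q * (p + q))"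
    using assms by (simp add: field_simps power2_eq_square)
  also have "\<dots> \<ge> 0" using assms by simp
  finally show ?thesis by simp
qed

text \<open>Nonnegativity of the variance: expand \<open>(f x - k)^2\<close> over \<open>S\<close>,
  with \<open>k\<close> the mean of \<open>f\<close> on \<open>S\<close>.\<close>

lemma integral_square_divide_le:
  fixes f :: "'a \<Rightarrow> real"
  assumes [measurable]: "f \<in> borel_measurable M" "S \<in> sets M"
    and fin: "emeasure M S < \<infinity>"
    and int1: "integrable M (\<lambda>x. indicat_real S x * f x)"
    and int2: "integrable M (\<lambda>x. indicat_real S x * (f x)\<^sup>2)"
  shows "(\<integral>x. indicat_real S x * f x \<partial>M)\<^sup>2 / measure M S \<le> (\<integral>x. indicat_real S x * (f x)\<^sup>2 \<partial>M)"
proof (cases "measure M S = 0")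
  case True
  \<comment> \<open>Division by zero makes the left side 0.\<close>
  then show ?thesis by (simp add: integral_nonneg_AE)
next
  case False
  then have m: "0 < measure M S" by (simp add: zero_less_measure_iff)
  let ?a = "\<integral>x. indicat_real S x * f x \<partial>M"
  define k where "k = ?a / measure M S"
  have "0 \<le> (\<integral>x. indicat_real S x * (f x - k)\<^sup>2 \<partial>M)"
    by (simp add: integral_nonneg_AE)
  also have "\<dots> = (\<integral>x. indicat_real S x * (f x)\<^sup>2 - 2 * k * (indicat_real S x * f x) + k\<^sup>2 * indicat_real S x \<partial>M)"
    by (intro Bochner_Integration.integral_cong) (auto simp: power2_eq_square algebra_simps)
  also have "\<dots> = (\<integral>x. indicat_real S x * (f x)\<^sup>2 \<partial>M) - 2 * k * ?a + k\<^sup>2 * measure M S"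
    using int1 int2 fin by (simp add: sets.Int_space_eq2)
  also have "\<dots> = (\<integral>x. indicat_real S x * (f x)\<^sup>2 \<partial>M) - ?a\<^sup>2 / measure M S"
    using m by (simp add: k_def power2_eq_square field_simps)
  finally show ?thesis by simp
qed

text \<open>Two fixed sets \<open>I\<close>, \<open>J\<close> cut all slices with
  \<open>t1 <= t < t2\<close>, so a part depends on \<open>t\<close> only through the superlevel
  set; this gives joint measurability in level and point. The last three assumptions make the
  uniform distributions on slices and parts probability measures.\<close>

locale split_slices = sigma_finite_measure M for M :: "real measure" +
  fixes w :: "real \<Rightarrow> real" and I J :: "real set" and t1 t2 :: real
  assumes w_measurable [measurable]: "w \<in> borel_measurable M"
    and w_pos: "x \<in> space M \<Longrightarrow> 0 < w x"
    and w_integrable: "integrable M w"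
    and I_sets [measurable]: "I \<in> sets M"
    and J_sets [measurable]: "J \<in> sets M"
    and disjoint: "I \<inter> J = {}"
    and t1_pos: "0 < t1"
    and cover: "t1 \<le> t \<Longrightarrow> t < t2 \<Longrightarrow> x \<in> space M \<Longrightarrow> t < w x \<Longrightarrow> x \<in> I \<union> J"
    and level_nonnull: "0 < t \<Longrightarrow> x \<in> space M \<Longrightarrow> t < w x \<Longrightarrow> 0 < emeasure M {x \<in> space M. t < w x}"
    and I_nonnull: "t1 \<le> t \<Longrightarrow> t < t2 \<Longrightarrow> 0 < emeasure M ({x \<in> space M. t < w x} \<inter> I)"
    and J_nonnull: "t1 \<le> t \<Longrightarrow> t < t2 \<Longrightarrow> 0 < emeasure M ({x \<in> space M. t < w x} \<inter> J)"
begin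

definition L :: "real \<Rightarrow> real set" where "L t = {x \<in> space M. t < w x}"

lemma L_sets [measurable]: "L t \<in> sets M"
  unfolding L_def by measurable

lemma L_Int_space [simp]: "L t \<inter> space M = L t"
  by (auto simp: L_def)

text \<open>Markov's inequality: \<open>t\<close> times the mass of \<open>L t\<close> is at most
  the integral of \<open>w\<close>.\<close>

lemma emeasure_L_finite:
  assumes "0 < t"
  shows "emeasure M (L t) < \<infinity>"
proof -
  have "ennreal t * emeasure M (L t) = (\<integral>\<^sup>+ x. ennreal t * indicator (L t) x \<partial>M)"
    by (simp add: nn_integral_cmult_indicator)
  also have "\<dots> \<le> (\<integral>\<^sup>+ x. ennreal (norm (w x)) \<partial>M)"
    using w_pos by (intro nn_integral_mono) (auto simp: L_def indicator_def less_imp_le intro!: ennreal_leI)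
  also have "\<dots> < \<infinity>"
    using w_integrable unfolding integrable_iff_bounded by simp
  finally show ?thesis
    using assms by (auto simp: ennreal_mult_less_top less_top[symmetric] ennreal_mult_eq_top_iff)
qed

lemma emeasure_part_finite:
  assumes "0 < t" and [measurable]: "S \<in> sets M"
  shows "emeasure M (L t \<inter> S) < \<infinity>"
  by (rule le_less_trans[OF emeasure_mono emeasure_L_finite[OF assms(1)]]) auto

lemma emeasure_part:
  assumes "0 < t" and "S \<in> sets M"
  shows "emeasure M (L t \<inter> S) = ennreal (measure M (L t \<inter> S))"
  using emeasure_part_finite[OF assms] by (intro emeasure_eq_ennreal_measure) simp

lemma level_pos: "0 < t \<Longrightarrow> x \<in> space M \<Longrightarrow> t < w x \<Longrightarrow> 0 < measure M (L t)"
  using level_nonnull[of t x] emeasure_part[of t "space M"] by (simp flip: L_def)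

lemma I_pos: "t1 \<le> t \<Longrightarrow> t < t2 \<Longrightarrow> 0 < measure M (L t \<inter> I)"
  using I_nonnull[of t] emeasure_part[of t I] t1_pos by (simp flip: L_def)

lemma J_pos: "t1 \<le> t \<Longrightarrow> t < t2 \<Longrightarrow> 0 < measure M (L t \<inter> J)"
  using J_nonnull[of t] emeasure_part[of t J] t1_pos by (simp flip: L_def)

text \<open>For \<open>x\<close> in the part \<open>L t \<inter> S\<close> this is the uniform
  density on that part; the indicator in \<open>x\<close> keeps the chain within its part and makes
  the expression symmetric. On a null part it vanishes by division by zero.\<close>

definition block :: "real set \<Rightarrow> real \<Rightarrow> real \<Rightarrow> real \<Rightarrow> real" where
  "block S t x y = indicat_real (L t \<inter> S) x * indicat_real (L t \<inter> S) y / measure M (L t \<inter> S)"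

lemma block_nonneg: "0 \<le> block S t x y"
  by (simp add: block_def)

lemma block_sym: "block S t x y = block S t y x"
  by (simp add: block_def mult.commute)

lemma indicator_part_measurable [measurable (raw)]:
  assumes [measurable]: "S \<in> sets M" "a \<in> borel_measurable N" "b \<in> measurable N M"
  shows "(\<lambda>p. indicat_real (L (a p) \<inter> S) (b p)) \<in> borel_measurable N"
proof -
  have "(\<lambda>p. if a p < w (b p) then indicat_real S (b p) else 0) \<in> borel_measurable N"
    by measurable
  then show ?thesis
    by (rule measurable_cong[THEN iffD1, rotated])
       (use measurable_space[OF assms(3)] in \<open>auto simp: L_def indicator_def\<close>)
qed

lemma measure_part_measurable [measurable (raw)]:
  assumes [measurable]: "S \<in> sets M" "a \<in> borel_measurable N"
  shows "(\<lambda>p. measure M (L (a p) \<inter> S)) \<in> borel_measurable N"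
proof -
  have "(\<lambda>t. enn2real (\<integral>\<^sup>+ x. ennreal (indicat_real (L t \<inter> S) x) \<partial>M)) \<in> borel_measurable borel"
    by measurable
  also have "(\<lambda>t. enn2real (\<integral>\<^sup>+ x. ennreal (indicat_real (L t \<inter> S) x) \<partial>M)) = (\<lambda>t. measure M (L t \<inter> S))"
    by (simp add: ennreal_indicator measure_def)
  finally show ?thesis
    by (rule measurable_compose[OF assms(2)])
qed

lemma block_measurable [measurable (raw)]:
  assumes [measurable]: "S \<in> sets M" "a \<in> borel_measurable N" "b \<in> measurable N M" "c \<in> measurable N M"
  shows "(\<lambda>p. block S (a p) (b p) (c p)) \<in> borel_measurable N"
  unfolding block_def by measurable

lemma nn_integral_block:
  assumes t: "0 < t" and S [measurable]: "S \<in> sets M" and A [measurable]: "A \<in> sets M"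
  shows "(\<integral>\<^sup>+ y. ennreal (block S t x y) * indicator A y \<partial>M)
    = indicator (L t \<inter> S) x * emeasure (uniform_measure M (L t \<inter> S)) A"
proof (cases "measure M (L t \<inter> S) = 0")
  case True
  \<comment> \<open>On a null part both sides vanish: the uniform measure takes the value 0 / 0 = 0,
    and \<open>block\<close> divides by 0.\<close>
  then have "emeasure M (L t \<inter> S) = 0" by (simp add: emeasure_part[OF t S])
  then have "emeasure M (L t \<inter> S \<inter> A) = 0"
    using emeasure_mono[OF Int_lower1, of "L t \<inter> S" M A] by simp
  then have "emeasure (uniform_measure M (L t \<inter> S)) A = 0"
    by (subst emeasure_uniform_measure) auto
  moreover have "block S t x y = 0" for y
    by (simp add: block_def True)
  ultimately show ?thesis by simp
next
  case False
  then have m: "0 < measure M (L t \<inter> S)" by (simp add: zero_less_measure_iff)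
  let ?c = "1 / measure M (L t \<inter> S)"
  have "(\<integral>\<^sup>+ y. ennreal (block S t x y) * indicator A y \<partial>M)
      = (\<integral>\<^sup>+ y. (indicator (L t \<inter> S) x * ennreal ?c) * indicator (L t \<inter> S \<inter> A) y \<partial>M)"
    by (intro nn_integral_cong) (simp add: block_def split: split_indicator)
  also have "\<dots> = indicator (L t \<inter> S) x * (ennreal ?c * emeasure M (L t \<inter> S \<inter> A))"
    by (subst nn_integral_cmult_indicator) (auto simp: mult.assoc)
  also have "ennreal ?c = inverse (emeasure M (L t \<inter> S))"
    using m by (simp add: emeasure_part[OF t S] inverse_ennreal inverse_eq_divide)
  also have "inverse (emeasure M (L t \<inter> S)) * emeasure M (L t \<inter> S \<inter> A) = emeasure (uniform_measure M (L t \<inter> S)) A"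
    by (subst emeasure_uniform_measure) (auto simp: divide_ennreal_def mult.commute)
  finally show ?thesis .
qed

text \<open>The guard serves \<open>Q_mass\<close>: as \<open>w\<close> is positive,
  \<open>L t\<close> is the whole space for \<open>t <= 0\<close>, yet such levels must carry no
  mass.\<close>

definition Q :: "(real \<Rightarrow> real) \<Rightarrow> real \<Rightarrow> real \<Rightarrow> real \<Rightarrow> real" where
  "Q l t x y = (if 0 < t then l t * block (space M) t x y + (1 - l t) * (block I t x y + block J t x y) else 0)"

lemma nn_integral_Q:
  assumes t: "0 < t" and l: "0 \<le> l t" "l t \<le> 1" and A [measurable]: "A \<in> sets M"
  shows "(\<integral>\<^sup>+ y. ennreal (Q l t x y) * indicator A y \<partial>M)
    = ennreal (l t) * (indicator (L t) x * emeasure (uniform_measure M (L t)) A)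
      + ennreal (1 - l t) * (indicator (L t \<inter> I) x * emeasure (uniform_measure M (L t \<inter> I)) A
          + indicator (L t \<inter> J) x * emeasure (uniform_measure M (L t \<inter> J)) A)"
proof -
  have [measurable]: "(\<lambda>y. block S t x y) \<in> borel_measurable M" if [measurable]: "S \<in> sets M" for S
    unfolding block_def by measurable
  have "(\<integral>\<^sup>+ y. ennreal (Q l t x y) * indicator A y \<partial>M)
     = (\<integral>\<^sup>+ y. ennreal (l t) * (ennreal (block (space M) t x y) * indicator A y)
        + ennreal (1 - l t) * (ennreal (block I t x y) * indicator A y + ennreal (block J t x y) * indicator A y) \<partial>M)"
    using t l by (intro nn_integral_cong)
      (auto simp: Q_def indicator_def ennreal_plus[symmetric] ennreal_mult[symmetric] block_nonneg simp del: ennreal_plus)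
  also have "\<dots> = ennreal (l t) * (\<integral>\<^sup>+ y. ennreal (block (space M) t x y) * indicator A y \<partial>M)
      + ennreal (1 - l t) * ((\<integral>\<^sup>+ y. ennreal (block I t x y) * indicator A y \<partial>M)
      + (\<integral>\<^sup>+ y. ennreal (block J t x y) * indicator A y \<partial>M))"
    by (subst nn_integral_add, measurable, subst nn_integral_cmult, measurable,
        subst nn_integral_cmult, measurable, subst nn_integral_add, measurable)
  finally show ?thesis
    by (simp add: nn_integral_block[OF t])
qed

section \<open>Quadratic form of a single slice\<close>

definition slice_form :: "(real \<Rightarrow> real) \<Rightarrow> (real \<Rightarrow> real) \<Rightarrow> real \<Rightarrow> real" where
  "slice_form l f t = (\<integral>x. indicat_real {0<..<w x} t * (f x)\<^sup>2 \<partial>M) - (\<integral>x. (\<integral>y. Q l t x y * f x * f y \<partial>M) \<partial>M)"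

context
  fixes f :: "real \<Rightarrow> real" and t :: real
  assumes f_measurable [measurable]: "f \<in> borel_measurable M"
    and t_pos: "0 < t"
    and L2_slice: "integrable M (\<lambda>x. indicat_real {0<..<w x} t * (f x)\<^sup>2)"
begin

lemma indicator_below_eq: "x \<in> space M \<Longrightarrow> indicat_real {0<..<w x} t = indicat_real (L t) x"
  using t_pos by (simp add: L_def indicator_def)

lemma integrable_part_square:
  assumes [measurable]: "S \<in> sets M"
  shows "integrable M (\<lambda>x. indicat_real (L t \<inter> S) x * (f x)\<^sup>2)"
  by (rule Bochner_Integration.integrable_bound[OF L2_slice])
     (measurable, auto intro!: AE_I2 simp: indicator_below_eq simp del: indicator_simps(1) split: split_indicator)

text \<open>On a part of finite measure square integrability gives integrability, via
  \<open>|f| <= 1 + f^2\<close>.\<close>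

lemma integrable_part:
  assumes [measurable]: "S \<in> sets M"
  shows "integrable M (\<lambda>x. indicat_real (L t \<inter> S) x * f x)"
proof (rule Bochner_Integration.integrable_bound)
  show "integrable M (\<lambda>x. indicat_real (L t \<inter> S) x + indicat_real (L t \<inter> S) x * (f x)\<^sup>2)"
    using emeasure_part_finite[OF t_pos assms]
    by (intro Bochner_Integration.integrable_add integrable_part_square) auto
  have "\<bar>f x\<bar> \<le> 1 + (f x)\<^sup>2" for x
    using sum_squares_bound[of 1 "\<bar>f x\<bar>"] by simp
  then show "AE x in M. norm (indicat_real (L t \<inter> S) x * f x)
      \<le> norm (indicat_real (L t \<inter> S) x + indicat_real (L t \<inter> S) x * (f x)\<^sup>2)"
    by (auto simp: indicator_def)
qed measurable

definition energy :: "real set \<Rightarrow> real" where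
  "energy S = (\<integral>x. indicat_real (L t \<inter> S) x * (f x)\<^sup>2 \<partial>M)"

text \<open>On a part of positive mass, the squared norm of the projection of \<open>f\<close> onto
  the constants; \<open>energy S - mean_energy S\<close> is then the mass times the variance of
  \<open>f\<close> under the uniform distribution.\<close>

definition mean_energy :: "real set \<Rightarrow> real" where
  "mean_energy S = (\<integral>x. indicat_real (L t \<inter> S) x * f x \<partial>M)\<^sup>2 / measure M (L t \<inter> S)"

lemma mean_energy_le: "S \<in> sets M \<Longrightarrow> mean_energy S \<le> energy S"
  unfolding mean_energy_def energy_def
  by (intro integral_square_divide_le integrable_part integrable_part_square emeasure_part_finite t_pos) auto

lemma integrable_block_inner:
  assumes [measurable]: "S \<in> sets M"
  shows "integrable M (\<lambda>y. block S t x y * f x * f y)"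
proof -
  have "(\<lambda>y. block S t x y * f x * f y)
      = (\<lambda>y. indicat_real (L t \<inter> S) x * f x / measure M (L t \<inter> S) * (indicat_real (L t \<inter> S) y * f y))"
    by (auto simp: block_def)
  then show ?thesis using integrable_part[OF assms] by simp
qed

text \<open>\<open>block\<close> has rank one, so everything depending on \<open>x\<close> leaves
  the integral over \<open>y\<close>. Integrating over \<open>x\<close> as well produces the square
  in \<open>mean_energy\<close>.\<close>

lemma integral_block_inner:
  assumes [measurable]: "S \<in> sets M"
  shows "(\<integral>y. block S t x y * f x * f y \<partial>M)
    = (\<integral>x. indicat_real (L t \<inter> S) x * f x \<partial>M) / measure M (L t \<inter> S) * (indicat_real (L t \<inter> S) x * f x)"
proof -
  have "(\<lambda>y. block S t x y * f x * f y)
      = (\<lambda>y. indicat_real (L t \<inter> S) x * f x / measure M (L t \<inter> S) * (indicat_real (L t \<inter> S) y * f y))"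
    by (auto simp: block_def)
  then show ?thesis by simp
qed

text \<open>Each block contributes its mean energy, so the form is affine in \<open>l t\<close>, and
  forms for different weights are compared through this coefficient alone.\<close>

lemma slice_form_eq:
  "slice_form l f t = energy (space M) - (l t * mean_energy (space M) + (1 - l t) * (mean_energy I + mean_energy J))"
proof -
  have inner: "(\<integral>y. Q l t x y * f x * f y \<partial>M)
      = l t * (\<integral>y. block (space M) t x y * f x * f y \<partial>M)
        + (1 - l t) * ((\<integral>y. block I t x y * f x * f y \<partial>M) + (\<integral>y. block J t x y * f x * f y \<partial>M))" for x
  proof -
    have "(\<lambda>y. Q l t x y * f x * f y) = (\<lambda>y. l t * (block (space M) t x y * f x * f y)
        + (1 - l t) * (block I t x y * f x * f y + block J t x y * f x * f y))"
      using t_pos by (auto simp: Q_def algebra_simps)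
    then show ?thesis by (simp add: integrable_block_inner)
  qed
  have int: "integrable M (\<lambda>x. \<integral>y. block S t x y * f x * f y \<partial>M)"
    and eq: "(\<integral>x. (\<integral>y. block S t x y * f x * f y \<partial>M) \<partial>M) = mean_energy S" if "S \<in> sets M" for S
    using integrable_part[OF that]
    by (simp_all add: integral_block_inner[OF that] mean_energy_def power2_eq_square)
  have "(\<integral>x. (\<integral>y. Q l t x y * f x * f y \<partial>M) \<partial>M)
      = l t * mean_energy (space M) + (1 - l t) * (mean_energy I + mean_energy J)"
    unfolding inner by (simp add: int eq)
  moreover have "(\<integral>x. indicat_real {0<..<w x} t * (f x)\<^sup>2 \<partial>M) = energy (space M)"
    unfolding energy_def by (intro Bochner_Integration.integral_cong) (auto simp: indicator_below_eq)
  ultimately show ?thesis by (simp add: slice_form_def)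
qed

context
  assumes t_range: "t1 \<le> t" "t < t2"
begin

lemma indicator_L_split: "indicat_real (L t) x = indicat_real (L t \<inter> I) x + indicat_real (L t \<inter> J) x"
  using cover[OF t_range, of x] disjoint by (auto simp: indicator_def L_def)

lemma measure_L_split: "measure M (L t) = measure M (L t \<inter> I) + measure M (L t \<inter> J)"
proof -
  have "L t = (L t \<inter> I) \<union> (L t \<inter> J)" using cover[OF t_range] by (auto simp: L_def)
  also have "measure M \<dots> = measure M (L t \<inter> I) + measure M (L t \<inter> J)"
    using disjoint emeasure_part_finite[OF t_pos]
    by (intro measure_Union) (auto simp: less_top)
  finally show ?thesis .
qed

lemma energy_split: "energy (space M) = energy I + energy J"
  using integrable_part_square[of I] integrable_part_square[of J]
  by (simp add: energy_def indicator_L_split distrib_right)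

lemma mean_energy_split: "mean_energy (space M) \<le> mean_energy I + mean_energy J"
  using integrable_part[of I] integrable_part[of J] I_pos[OF t_range] J_pos[OF t_range]
  by (simp add: mean_energy_def indicator_L_split distrib_right measure_L_split
      sum_square_divide_le flip: L_def)

end

lemma slice_form_bounds:
  assumes "0 \<le> l t" "l t \<le> 1" and "r \<le> l t" and one: "t \<notin> {t1..<t2} \<Longrightarrow> l t = 1"
  shows "r * slice_form (\<lambda>_. 1) f t \<le> slice_form l f t" "slice_form l f t \<le> slice_form (\<lambda>_. 1) f t"
proof -
  let ?V = "energy (space M) - mean_energy (space M)"
  have V: "0 \<le> ?V" using mean_energy_le[of "space M"] by simp
  have U: "slice_form (\<lambda>_. 1) f t = ?V" by (simp add: slice_form_eq)
  have rV: "r * ?V \<le> l t * ?V"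
    using V assms(3) by (rule mult_right_mono[rotated])
  have "l t * ?V \<le> slice_form l f t \<and> slice_form l f t \<le> ?V"
  proof (cases "t \<in> {t1..<t2}")
    case True
    then have t: "t1 \<le> t" "t < t2" by auto
    \<comment> \<open>Times \<open>1 - l t\<close> this is the excess of the form over
      \<open>l t * ?V\<close>; Cauchy-Schwarz on each part makes it nonnegative.\<close>
    have "0 \<le> energy (space M) - (mean_energy I + mean_energy J)"
      using mean_energy_le[OF I_sets] mean_energy_le[OF J_sets] energy_split[OF t] by simp
    then have "0 \<le> (1 - l t) * (energy (space M) - (mean_energy I + mean_energy J))"
      using assms(2) by simp
    \<comment> \<open>This term is \<open>?V\<close> minus the form; it is nonnegative because
      cutting the slice cannot lower the mean energy.\<close>
    moreover have "0 \<le> (1 - l t) * (mean_energy I + mean_energy J - mean_energy (space M))"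
      using assms(2) mean_energy_split[OF t] by simp
    ultimately show ?thesis
      by (simp add: slice_form_eq algebra_simps)
  next
    case False
    then show ?thesis using one by (simp add: slice_form_eq)
  qed
  with rV U show "r * slice_form (\<lambda>_. 1) f t \<le> slice_form l f t" "slice_form l f t \<le> slice_form (\<lambda>_. 1) f t"
    by simp_all
qed

end

end

section \<open>Comparison of mixed kernels\<close>

locale weighted_slices = split_slices +
  fixes l :: "real \<Rightarrow> real"
  assumes l_measurable [measurable]: "l \<in> borel_measurable borel"
    and l_nonneg: "0 \<le> l t"
    and l_le_one: "l t \<le> 1"
    and l_eq_one: "t \<notin> {t1..<t2} \<Longrightarrow> l t = 1"
begin

text \<open>The decisive point is the mass: for \<open>0 < t < w x\<close> the coefficients of the
  mixture add up to 1. If \<open>t1 <= t < t2\<close>, this uses that \<open>x\<close> lies in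
  exactly one of \<open>I\<close>, \<open>J\<close>; at other levels the weight is 1 and the parts
  drop out.\<close>

sublocale layered_kernel M w "Q l"
proof
  show "(\<lambda>p. Q l (fst p) (fst (snd p)) (snd (snd p))) \<in> borel_measurable (lborel \<Otimes>\<^sub>M (M \<Otimes>\<^sub>M M))"
    unfolding Q_def by measurable
  show "0 \<le> Q l t x y" for t x y
    by (auto simp: Q_def block_nonneg l_nonneg l_le_one)
  show "Q l t x y = Q l t y x" for t x y
    by (simp add: Q_def block_sym[of _ t x y])
  show "(\<integral>\<^sup>+ y. ennreal (Q l t x y) \<partial>M) = indicator {0<..<w x} t" if x: "x \<in> space M" for t x
  proof (cases "0 < t \<and> t < w x")
    case True
    have uniform: "emeasure (uniform_measure M (L t \<inter> S)) (space M) = 1"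
      if "S \<in> sets M" "0 < measure M (L t \<inter> S)" for S
      using that True sets.sets_into_space[of "L t \<inter> S" M]
      by (simp add: emeasure_part Int_absorb2 ennreal_zero_less_divide divide_ennreal)
    have uniform_L: "emeasure (uniform_measure M (L t)) (space M) = 1"
      using uniform[of "space M"] level_pos[of t x] True x by (simp flip: L_def)
    have "(\<integral>\<^sup>+ y. ennreal (Q l t x y) \<partial>M) = (\<integral>\<^sup>+ y. ennreal (Q l t x y) * indicator (space M) y \<partial>M)"
      by (intro nn_integral_cong) simp
    also have "\<dots> = 1"
    proof (cases "t \<in> {t1..<t2}")
      case t: True
      then have "indicator (L t \<inter> I) x + indicator (L t \<inter> J) x = (1 :: ennreal)"
        using cover[of t x] disjoint x True by (auto simp: indicator_def L_def)
      moreover have "emeasure (uniform_measure M (L t \<inter> I)) (space M) = 1" "emeasure (uniform_measure M (L t \<inter> J)) (space M) = 1"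
        using t I_pos[of t] J_pos[of t] by (auto intro!: uniform simp del: emeasure_uniform_measure simp flip: L_def)
      moreover have "ennreal (l t) + ennreal (1 - l t) = 1"
        using l_nonneg[of t] l_le_one[of t] by (simp flip: ennreal_plus)
      moreover have "x \<in> L t" using x True by (simp add: L_def)
      ultimately show ?thesis
        using True l_nonneg[of t] l_le_one[of t]
        by (subst nn_integral_Q) (simp_all add: uniform_L del: emeasure_uniform_measure)
    next
      case False
      moreover have "x \<in> L t" using x True by (simp add: L_def)
      ultimately show ?thesis
        using True by (subst nn_integral_Q) (simp_all add: l_eq_one uniform_L del: emeasure_uniform_measure)
    qed
    finally show ?thesis using True by simp
  next
    case False
    then have "Q l t x y = 0" for y by (auto simp: Q_def block_def L_def)
    then show ?thesis using False by simp
  qed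
qed (auto intro: w_pos)

text \<open>Common shape of the ideal and the hybrid kernel, with \<open>\<kappa> t\<close> the law
  at level \<open>t\<close>. For \<open>0 < t < w x\<close> the point \<open>x\<close> lies in
  \<open>L t\<close>, so membership in a part of the slice reduces to membership in \<open>I\<close>
  or \<open>J\<close>.\<close>

lemma measure_of_eq_kernel:
  assumes x: "x \<in> space M"
    and \<mu>: "\<And>A. A \<in> sets M \<Longrightarrow> \<mu> A = (\<integral>\<^sup>+ t \<in> {0<..<w x}. \<kappa> t A \<partial>lborel) / ennreal (w x)"
    and \<kappa>: "\<And>t A. 0 < t \<Longrightarrow> t < w x \<Longrightarrow> A \<in> sets M \<Longrightarrow> \<kappa> t A =
        ennreal (l t) * emeasure (uniform_measure M (L t)) A
        + ennreal (1 - l t) * (indicator I x * emeasure (uniform_measure M (L t \<inter> I)) A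
          + indicator J x * emeasure (uniform_measure M (L t \<inter> J)) A)"
  shows "measure_of (space M) (sets M) \<mu> = kernel x"
proof (rule kernel_eqI[OF x])
  fix A assume A: "A \<in> sets M"
  have "\<kappa> t A * indicator {0<..<w x} t = (\<integral>\<^sup>+ y. ennreal (Q l t x y) * indicator A y \<partial>M)" for t
  proof (cases "0 < t \<and> t < w x")
    case True
    then have "x \<in> L t" using x by (simp add: L_def)
    then show ?thesis
      using True A by (simp add: \<kappa> nn_integral_Q l_nonneg l_le_one indicator_inter_arith)
  next
    case False
    then have "Q l t x y = 0" for y by (auto simp: Q_def block_def L_def)
    then show ?thesis using False by auto
  qed
  then show "\<mu> A = (\<integral>\<^sup>+ t. (\<integral>\<^sup>+ y. ennreal (Q l t x y) * indicator A y \<partial>M) \<partial>lborel) / ennreal (w x)"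
    by (simp add: \<mu>[OF A])
qed

lemma layer_form_eq: "layer_form f t = slice_form l f t"
  if "f \<in> borel_measurable M" "integrable M (\<lambda>x. w x * (f x)\<^sup>2)"
  using that by (simp add: layer_form_def slice_form_def)

lemma slice_form_nonpos: "t \<le> 0 \<Longrightarrow> slice_form l f t = 0"
  by (simp add: slice_form_def Q_def)

theorem dirichlet_form_bounds:
  assumes f [measurable]: "f \<in> borel_measurable M" and L2: "integrable M (\<lambda>x. w x * (f x)\<^sup>2)"
    and c: "0 < c" and r: "\<And>t. r \<le> l t"
  defines "D \<equiv> \<lambda>P. dirichlet_form (density M (\<lambda>x. ennreal (w x / c))) P f"
  shows "r * D (layered_kernel.kernel M w (Q (\<lambda>_. 1))) \<le> D kernel"
    and "D kernel \<le> D (layered_kernel.kernel M w (Q (\<lambda>_. 1)))"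
proof -
  interpret U: weighted_slices M w I J t1 t2 "\<lambda>_. 1"
    by unfold_locales auto
  have int_U: "integrable lborel (slice_form (\<lambda>_. 1) f)" and int_l: "integrable lborel (slice_form l f)"
    using U.integrable_layer_form[OF f L2] integrable_layer_form[OF f L2]
    by (simp_all add: U.layer_form_eq[OF f L2] layer_form_eq[OF f L2] cong: Bochner_Integration.integrable_cong)
  have D_U: "D U.kernel = (\<integral>t. slice_form (\<lambda>_. 1) f t \<partial>lborel) / c"
    unfolding D_def using U.dirichlet_form_kernel[OF f L2 c] by (simp add: U.layer_form_eq[OF f L2])
  have D_l: "D kernel = (\<integral>t. slice_form l f t \<partial>lborel) / c"
    unfolding D_def using dirichlet_form_kernel[OF f L2 c] by (simp add: layer_form_eq[OF f L2])
  \<comment> \<open>Slices on which \<open>f\<close> is not square integrable form a null set of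
    levels, and for \<open>t <= 0\<close> both forms are 0.\<close>
  have AE: "AE t in lborel. r * slice_form (\<lambda>_. 1) f t \<le> slice_form l f t \<and> slice_form l f t \<le> slice_form (\<lambda>_. 1) f t"
    using AE_integrable_square[OF f L2]
  proof eventually_elim
    case (elim t)
    show ?case
    proof (cases "0 < t")
      case True
      with slice_form_bounds[OF f this elim, of l r] show ?thesis
        by (simp add: l_nonneg l_le_one l_eq_one r)
    next
      case False
      then show ?thesis by (simp add: slice_form_nonpos U.slice_form_nonpos)
    qed
  qed
  have "r * (\<integral>t. slice_form (\<lambda>_. 1) f t \<partial>lborel) = (\<integral>t. r * slice_form (\<lambda>_. 1) f t \<partial>lborel)"
    by simp
  also have "\<dots> \<le> (\<integral>t. slice_form l f t \<partial>lborel)"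
    using AE int_U int_l by (intro integral_mono_AE) auto
  finally show "r * D U.kernel \<le> D kernel"
    using c by (simp add: D_U D_l divide_right_mono less_imp_le)
  have "(\<integral>t. slice_form l f t \<partial>lborel) \<le> (\<integral>t. slice_form (\<lambda>_. 1) f t \<partial>lborel)"
    using AE int_U int_l by (intro integral_mono_AE) auto
  then show "D kernel \<le> D U.kernel"
    using c by (simp add: D_U D_l divide_right_mono less_imp_le)
qed

end

section \<open>Bimodal densities\<close>

lemma dirichlet_form_cong:
  assumes "\<And>x. x \<in> space M \<Longrightarrow> P x = P' x"
  shows "dirichlet_form M P f = dirichlet_form M P' f"
  unfolding dirichlet_form_def using assms by (intro Bochner_Integration.integral_cong) auto

text \<open>Cross multiplication reduces the claim to \<open>m * d <= n * e\<close>. If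
  \<open>m + e = 0\<close>, the left side is 0.\<close>

lemma divide_add_mono:
  fixes m n d e :: real
  assumes "0 \<le> m" "m \<le> n" "0 \<le> d" "d \<le> e" "0 < n"
  shows "m / (m + e) \<le> n / (n + d)"
proof (cases "m + e = 0")
  case False
  then have "0 < m + e" using assms by linarith
  moreover have "m * d \<le> n * e" using assms by (intro mult_mono) auto
  ultimately show ?thesis using assms by (simp add: field_simps)
qed (use assms in simp)

locale bimodal_density =
  fixes G :: "real set" and w :: "real \<Rightarrow> real" and t1 t2 h :: real and G1 G2 :: "real \<Rightarrow> real set"
  assumes G_borel [measurable]: "G \<in> sets borel"
    and w_measurable [measurable]: "w \<in> borel_measurable (nu G)"
    and w_pos_on_G: "x \<in> G \<Longrightarrow> 0 < w x"
    and mass_pos: "0 < norm_const G w" and mass_finite: "norm_const G w < \<infinity>"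
    and esssup_eq: "esssup (nu G) (\<lambda>x. ereal (w x)) = sup_on G w"
    and t1_level: "t1 \<in> levels G w" and t2_level: "t2 \<in> levels G w"
    and bimodal: "bimodal G w t1 t2 G1 G2"
    and h_pos: "0 < h" and gap_le_h: "max_gap G w t1 t2 G1 G2 \<le> ereal h"
begin

lemma space_nu [simp]: "space (nu G) = G"
  by (simp add: space_restrict_space)

lemma sets_nu_iff: "A \<in> sets (nu G) \<longleftrightarrow> A \<in> sets borel \<and> A \<subseteq> G"
  by (auto simp: sets_restrict_space_iff)

lemma level_set_eq: "{x \<in> space (nu G). t < w x} = level_set G w t"
  by (simp add: level_set_def)

lemma level_set_sets [measurable]: "level_set G w t \<in> sets (nu G)"
  unfolding level_set_eq[symmetric] by measurable

lemma component:
  assumes "t \<in> {t1..<t2}"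
  shows "nondegenerate_interval (G1 t)" "nondegenerate_interval (G2 t)" "G1 t \<inter> G2 t = {}"
    "level_set G w t = G1 t \<union> G2 t"
  using assms bimodal unfolding bimodal_def by auto

lemma component_antimono:
  assumes "t1 \<le> s" "s \<le> t" "t < t2"
  shows "G1 t \<subseteq> G1 s" "G2 t \<subseteq> G2 s"
  using assms bimodal unfolding bimodal_def by auto

lemma component_eq:
  assumes "t \<in> {t1..<t2}"
  shows "G1 t = level_set G w t \<inter> G1 t1" "G2 t = level_set G w t \<inter> G2 t1"
  using assms component[of t] component[of t1] component_antimono[of t1 t] by auto

lemma component_nonempty:
  assumes "t \<in> {t1..<t2}"
  shows "G1 t \<noteq> {}" "G2 t \<noteq> {}"
  using component(1,2)[OF assms] by (auto simp: nondegenerate_interval_def)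

lemma component_sets:
  assumes "t \<in> {t1..<t2}"
  shows "G1 t \<in> sets (nu G)" "G2 t \<in> sets (nu G)"
  using component[OF assms]
  by (auto simp: sets_nu_iff nondegenerate_interval_def level_set_def real_interval_borel_measurable)

lemma emeasure_nondegenerate_pos:
  assumes "nondegenerate_interval S" "S \<subseteq> level_set G w t"
  shows "0 < emeasure (nu G) S"
proof -
  obtain a b where ab: "a \<in> S" "b \<in> S" "a < b" "is_interval S"
    using assms(1) unfolding nondegenerate_interval_def by blast
  have "S \<subseteq> G"
    using assms(2) by (auto simp: level_set_def)
  have sub: "{a..b} \<subseteq> S"
    using ab(4) unfolding is_interval_1 by (meson ab(1,2) atLeastAtMost_iff subsetI)
  have "ennreal (b - a) = emeasure lborel {a..b}"
    using ab(3) by simp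
  also have "\<dots> \<le> emeasure lborel S"
    using sub real_interval_borel_measurable[OF ab(4)] by (intro emeasure_mono) simp_all
  also have "\<dots> = emeasure (nu G) S"
    using \<open>S \<subseteq> G\<close> G_borel by (simp add: emeasure_restrict_space)
  finally have "ennreal (b - a) \<le> emeasure (nu G) S" .
  moreover have "0 < ennreal (b - a)" using ab(3) by simp
  ultimately show ?thesis by (rule less_le_trans[rotated])
qed

text \<open>Here the equality of supremum and essential supremum enters: below the essential
  supremum, \<open>w\<close> exceeds \<open>t\<close> on a set of positive measure.\<close>

lemma emeasure_level_pos:
  assumes "t \<in> levels G w"
  shows "0 < emeasure (nu G) (level_set G w t)"
proof -
  have "emeasure (nu G) {x \<in> space (nu G). ereal t < ereal (w x)} > 0"
  proof (rule esssup_pos_measure)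
    show "ereal t < esssup (nu G) (\<lambda>x. ereal (w x))"
      using assms unfolding esssup_eq by (simp add: levels_def)
  qed measurable
  then show ?thesis
    by (simp add: level_set_def)
qed

lemma below_level: "x \<in> G \<Longrightarrow> 0 < t \<Longrightarrow> t < w x \<Longrightarrow> t \<in> levels G w"
  unfolding levels_def sup_on_def by (auto simp: less_SUP_iff)

lemma between_levels: "t \<in> {t1..<t2} \<Longrightarrow> t \<in> levels G w"
  using t1_level t2_level unfolding levels_def by (auto intro: less_trans[of _ "ereal t2"])

abbreviation "\<delta> \<equiv> gap t1 t2 G1 G2"
abbreviation "\<Delta> \<equiv> real_of_ereal (max_gap G w t1 t2 G1 G2)"
abbreviation "weight \<equiv> step_weight G w t1 t2 G1 G2 h"

lemma gap_nonneg: "0 \<le> \<delta> t"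
  by (simp add: gap_def)

text \<open>The supremum is at least the gap at \<open>t1\<close> and at most \<open>h\<close>,
  hence finite, so \<open>real_of_ereal\<close> loses nothing.\<close>

lemma max_gap_eq: "max_gap G w t1 t2 G1 G2 = ereal \<Delta>"
proof -
  have "ereal (\<delta> t1) \<le> max_gap G w t1 t2 G1 G2"
    unfolding max_gap_def using t1_level by (rule SUP_upper)
  then have "max_gap G w t1 t2 G1 G2 \<noteq> - \<infinity>"
    by auto
  moreover have "max_gap G w t1 t2 G1 G2 \<noteq> \<infinity>"
    using gap_le_h by auto
  ultimately show ?thesis
    by (cases "max_gap G w t1 t2 G1 G2") auto
qed

lemma gap_le: "t \<in> levels G w \<Longrightarrow> \<delta> t \<le> \<Delta>"
proof -
  assume "t \<in> levels G w"
  then have "ereal (\<delta> t) \<le> max_gap G w t1 t2 G1 G2"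
    unfolding max_gap_def by (rule SUP_upper)
  then show ?thesis by (subst (asm) max_gap_eq) simp
qed

lemma max_gap_bounds: "0 \<le> \<Delta>" "\<Delta> \<le> h"
proof -
  show "0 \<le> \<Delta>" using gap_le[OF t1_level] gap_nonneg[of t1] by simp
  show "\<Delta> \<le> h" using gap_le_h by (subst (asm) max_gap_eq) simp
qed

text \<open>The components shrink as the level rises, so their distance grows, and a monotone
  function is Borel. Nonemptiness enters because \<open>setdist\<close> to an empty set is
  0.\<close>

lemma gap_measurable [measurable]: "\<delta> \<in> borel_measurable borel"
proof -
  have "mono_on {t1..<t2} (\<lambda>t. setdist (G1 t) (G2 t))"
  proof (rule mono_onI)
    fix s t assume st: "s \<in> {t1..<t2}" "t \<in> {t1..<t2}" "s \<le> t"
    have "setdist (G1 s) (G2 s) \<le> setdist (G1 t) (G2 s)"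
      using st by (intro setdist_subset_left component_nonempty component_antimono) auto
    also have "\<dots> \<le> setdist (G1 t) (G2 t)"
      using st by (intro setdist_subset_right component_nonempty component_antimono) auto
    finally show "setdist (G1 s) (G2 s) \<le> setdist (G1 t) (G2 t)" .
  qed
  from borel_measurable_mono_on_fnc[OF this]
  show ?thesis
    unfolding gap_def[abs_def] by (subst (asm) measurable_restrict_space_iff[where c=0]) auto
qed

text \<open>
  Every \<open>G1 t\<close> and \<open>G2 t\<close> is the part of the level set inside \<open>G1 t1\<close> resp. \<open>G2 t1\<close>, because these two
  are disjoint. This yields joint measurability of the components in level and point.
\<close>

definition I :: "real set" where "I = (if t1 < t2 then G1 t1 else {})"
definition J :: "real set" where "J = (if t1 < t2 then G2 t1 else {})"

lemma component_eq_Int: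
  assumes "t \<in> {t1..<t2}"
  shows "G1 t = level_set G w t \<inter> I" "G2 t = level_set G w t \<inter> J"
  using component_eq[OF assms] assms by (auto simp: I_def J_def)

sublocale split_slices "nu G" w I J t1 t2
proof (unfold_locales, goal_cases)
  case 1
  have "sigma_finite_measure (restrict_space lborel G)"
    by (rule sigma_finite_measure_restrict_space) (auto simp: lborel.sigma_finite_measure_axioms)
  then show ?case
    by (rule sigma_finite_measure.sigma_finite_countable)
next
  case 4
  show ?case
  proof (rule integrableI_bounded)
    have "(\<integral>\<^sup>+ x. ennreal (norm (w x)) \<partial>nu G) = norm_const G w"
      unfolding norm_const_def by (intro nn_integral_cong) (simp add: w_pos_on_G less_imp_le)
    then show "(\<integral>\<^sup>+ x. ennreal (norm (w x)) \<partial>nu G) < \<infinity>" using mass_finite by simp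
  qed measurable
next
  case 5
  \<comment> \<open>For \<open>t1 >= t2\<close> bimodality says nothing about \<open>G1 t1\<close>;
    the empty set in the definition of \<open>I\<close> covers that case.\<close>
  then show ?case using component_sets[of t1] by (auto simp: I_def)
next
  case 6
  then show ?case using component_sets[of t1] by (auto simp: J_def)
next
  case 7
  then show ?case using component(3)[of t1] by (auto simp: I_def J_def)
next
  case 8
  then show ?case using t1_level by (simp add: levels_def)
next
  case (9 t x)
  then have "x \<in> level_set G w t" and t: "t \<in> {t1..<t2}" by (auto simp: level_set_def)
  then have "x \<in> G1 t \<union> G2 t" using component(4)[OF t] by simp
  then show ?case unfolding component_eq_Int[OF t] by blast
next
  case (10 t x)
  then show ?case using emeasure_level_pos[of t] below_level[of x t] by (simp add: level_set_def)
next
  case (11 t)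
  then have t: "t \<in> {t1..<t2}" by simp
  show ?case
    unfolding level_set_eq component_eq_Int(1)[OF t, symmetric]
    by (rule emeasure_nondegenerate_pos[of _ t]) (use component[OF t] in auto)
next
  case (12 t)
  then have t: "t \<in> {t1..<t2}" by simp
  show ?case
    unfolding level_set_eq component_eq_Int(2)[OF t, symmetric]
    by (rule emeasure_nondegenerate_pos[of _ t]) (use component[OF t] in auto)
qed (auto intro: w_pos_on_G)

lemma L_eq: "L t = level_set G w t"
  by (simp add: L_def level_set_def)

lemma emeasure_level_finite: "0 < t \<Longrightarrow> emeasure (nu G) (level_set G w t) < \<infinity>"
  using emeasure_L_finite[of t] by (simp add: L_eq)

lemma measure_level_pos:
  assumes "t \<in> levels G w"
  shows "0 < measure (nu G) (level_set G w t)"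
  using emeasure_level_pos[OF assms] emeasure_level_finite[of t] assms
  by (simp add: measure_def enn2real_positive_iff levels_def)

text \<open>The condition on \<open>h\<close> bounds the gap by \<open>h\<close>, so both factors of
  the weight lie in [0, 1].\<close>

lemma step_weight_bounds:
  assumes "t \<in> {t1..<t2}"
  shows "0 \<le> weight t" "weight t \<le> 1"
proof -
  have d: "0 \<le> \<delta> t" "\<delta> t \<le> h"
    using gap_nonneg gap_le[OF between_levels[OF assms]] max_gap_bounds by auto
  show "0 \<le> weight t" using d h_pos by (simp add: step_weight_def)
  show "weight t \<le> 1"
    unfolding step_weight_def using d h_pos measure_level_pos[OF between_levels[OF assms]]
    by (intro mult_le_one) auto
qed

text \<open>The weight is set to 1 outside \<open>{t1..<t2}\<close>, where
  \<open>step_kernel\<close> is uniform on the whole slice; one mixture formula then covers all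
  levels.\<close>

sublocale hybrid: weighted_slices "nu G" w I J t1 t2 "\<lambda>t. if t \<in> {t1..<t2} then weight t else 1"
proof (unfold_locales, goal_cases)
  case 1
  have "(\<lambda>t. measure (nu G) (level_set G w t)) \<in> borel_measurable borel"
    using measure_part_measurable[of G "\<lambda>t. t" borel] by (simp add: sets_nu_iff L_eq Int_absorb2 level_set_def)
  then have "weight \<in> borel_measurable borel"
    unfolding step_weight_def[abs_def] by measurable
  then show ?case by measurable
qed (auto simp: step_weight_bounds)

sublocale ideal: weighted_slices "nu G" w I J t1 t2 "\<lambda>_. 1"
  by unfold_locales auto

section \<open>Identification of the concrete kernels\<close>

lemma ideal_kernel_eq:
  assumes x: "x \<in> G"
  shows "ideal_kernel G w x = ideal.kernel x"
  unfolding ideal_kernel_def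
  using ideal.measure_of_eq_kernel[of x _ "\<lambda>t. emeasure (uniform_measure (nu G) (level_set G w t))", OF _ refl] x
  by (simp add: L_eq)

lemma hybrid_kernel_eq:
  assumes x: "x \<in> G"
  shows "hybrid_kernel G w (step_kernel G w t1 t2 G1 G2 h) x = hybrid.kernel x"
  unfolding hybrid_kernel_def
proof (subst (1) space_nu[symmetric], rule hybrid.measure_of_eq_kernel[OF _ refl])
  fix t A assume t: "0 < t" "t < w x" and A [measurable]: "A \<in> sets (nu G)"
  \<comment> \<open>\<open>hybrid_kernel\<close> intersects \<open>A\<close> with the slice; this
    changes nothing, since uniform measures on parts of the slice live there.\<close>
  have unif: "emeasure (uniform_measure (nu G) (level_set G w t \<inter> S)) (A \<inter> level_set G w t)
      = emeasure (uniform_measure (nu G) (level_set G w t \<inter> S)) A" if [measurable]: "S \<in> sets (nu G)" for S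
  proof -
    have "level_set G w t \<inter> S \<inter> (A \<inter> level_set G w t) = level_set G w t \<inter> S \<inter> A" by auto
    then show ?thesis by simp
  qed
  have unif_L: "emeasure (uniform_measure (nu G) (level_set G w t)) (A \<inter> level_set G w t)
      = emeasure (uniform_measure (nu G) (level_set G w t)) A"
    using unif[of "level_set G w t"] by simp
  have "x \<in> level_set G w t" using x t by (simp add: level_set_def)
  then show "step_kernel G w t1 t2 G1 G2 h t x (A \<inter> level_set G w t) =
      ennreal (if t \<in> {t1..<t2} then weight t else 1) * emeasure (uniform_measure (nu G) (L t)) A +
      ennreal (1 - (if t \<in> {t1..<t2} then weight t else 1)) *
       (indicator I x * emeasure (uniform_measure (nu G) (L t \<inter> I)) A +
        indicator J x * emeasure (uniform_measure (nu G) (L t \<inter> J)) A)"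
    by (auto simp: step_kernel_def L_eq unif_L component_eq_Int unif indicator_inter_arith
        simp del: emeasure_uniform_measure)
qed (simp add: x)

lemma target_eq: "target G w = density (nu G) (\<lambda>x. ennreal (w x / enn2real (norm_const G w)))"
proof -
  let ?c = "enn2real (norm_const G w)"
  have c: "norm_const G w = ennreal ?c"
    using mass_finite by (simp add: less_top)
  have c_pos: "0 < ?c"
    using mass_pos mass_finite by (simp add: enn2real_positive_iff)
  have "ennreal (w x) / norm_const G w = ennreal (w x / ?c)" if "x \<in> G" for x
    using w_pos_on_G[OF that] c_pos by (subst c) (simp only: divide_ennreal less_imp_le)
  then show ?thesis
    unfolding target_def by (intro density_cong) (auto intro!: AE_I2)
qed

text \<open>Replacing \<open>\<delta> t\<close> by \<open>\<Delta>\<close> and the mass of the slice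
  by the infimum can only decrease the two factors of the weight.\<close>

lemma rho_le:
  assumes "t \<in> {t1..<t2}"
  defines "m \<equiv> min_mass G w t1 t2"
  shows "(h - \<Delta>) / h * (if m = \<infinity> then 1 else enn2real m / (enn2real m + \<Delta>)) \<le> weight t"
proof -
  have lev: "t \<in> levels G w" by (rule between_levels[OF assms(1)])
  then have t: "0 < t" by (simp add: levels_def)
  have m_le: "m \<le> emeasure (nu G) (level_set G w t)"
    unfolding m_def min_mass_def using assms(1) by (rule INF_lower)
  \<comment> \<open>Slices at positive levels have finite mass, so an infinite infimum occurs only
    over an empty range.\<close>
  then have "m \<noteq> \<infinity>" using emeasure_level_finite[OF t] by auto
  moreover have "enn2real m \<le> measure (nu G) (level_set G w t)"
    unfolding measure_def using m_le emeasure_level_finite[OF t] by (intro enn2real_mono) auto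
  then have "enn2real m / (enn2real m + \<Delta>)
      \<le> measure (nu G) (level_set G w t) / (measure (nu G) (level_set G w t) + \<delta> t)"
    by (intro divide_add_mono gap_nonneg gap_le lev measure_level_pos) auto
  then have "(h - \<Delta>) / h * (enn2real m / (enn2real m + \<Delta>)) \<le> weight t"
    unfolding step_weight_def using h_pos max_gap_bounds gap_le[OF lev]
    by (intro mult_mono divide_right_mono divide_nonneg_nonneg) auto
  ultimately show ?thesis by simp
qed

text \<open>Serves the levels outside \<open>{t1..<t2}\<close>, where the weight is 1; this includes
  all levels when the range is empty.\<close>

lemma rho_le_one:
  "(h - \<Delta>) / h * (if m = \<infinity> then 1 else enn2real m / (enn2real m + \<Delta>)) \<le> 1"
proof -
  have "a / (a + \<Delta>) \<le> 1" if "0 \<le> a" for a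
    using that max_gap_bounds(1) unfolding divide_le_eq_1 by linarith
  then show ?thesis
    using h_pos max_gap_bounds by (intro mult_le_one) auto
qed

end

theorem corollary32:
  fixes G :: "real set" and w :: "real \<Rightarrow> real"
    and t1 t2 h :: real and G1 G2 :: "real \<Rightarrow> real set"
    and f :: "real \<Rightarrow> real" and \<rho> \<Delta> :: real and m :: ennreal
  assumes "G \<in> sets borel"
    and "w \<in> borel_measurable (nu G)"
    and "\<And>x. x \<in> G \<Longrightarrow> 0 < w x"
    and "0 < norm_const G w" and "norm_const G w < \<infinity>"
    and "esssup (nu G) (\<lambda>x. ereal (w x)) = sup_on G w"
    and "t1 \<in> levels G w" and "t2 \<in> levels G w" and "t1 \<le> t2"
    and "bimodal G w t1 t2 G1 G2"
    and "0 < h" and "max_gap G w t1 t2 G1 G2 \<le> ereal h"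
    and "f \<in> L2_0 (target G w)"
  defines "\<Delta> \<equiv> real_of_ereal (max_gap G w t1 t2 G1 G2)"
    and "m \<equiv> min_mass G w t1 t2"
    and "\<rho> \<equiv> (h - \<Delta>) / h * (if m = \<infinity> then 1 else enn2real m / (enn2real m + \<Delta>))"
  shows "\<rho> * dirichlet_form (target G w) (ideal_kernel G w) f
           \<le> dirichlet_form (target G w) (hybrid_kernel G w (step_kernel G w t1 t2 G1 G2 h)) f
       \<and> dirichlet_form (target G w) (hybrid_kernel G w (step_kernel G w t1 t2 G1 G2 h)) f
           \<le> dirichlet_form (target G w) (ideal_kernel G w) f"
proof -
  interpret bimodal_density G w t1 t2 h G1 G2
    by unfold_locales (use assms in auto)
  let ?c = "enn2real (norm_const G w)"
  have c: "0 < ?c"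
    using assms(4,5) by (simp add: enn2real_positive_iff)
  have f: "f \<in> borel_measurable (nu G)" and "integrable (target G w) (\<lambda>x. (f x)\<^sup>2)"
    using assms(13) by (auto simp: L2_0_def target_eq)
  note [measurable] = f
  have "integrable (nu G) (\<lambda>x. w x / ?c * (f x)\<^sup>2)"
    using \<open>integrable (target G w) _\<close> c assms(3) unfolding target_eq
    by (subst (asm) integrable_density) (auto intro!: AE_I2 simp: less_imp_le)
  \<comment> \<open>Multiplying by \<open>?c\<close> removes the normalisation, as the comparison
    asks for integrability against the unnormalised \<open>w\<close>.\<close>
  then have "integrable (nu G) (\<lambda>x. ?c * (w x / ?c * (f x)\<^sup>2))"
    by (rule integrable_mult_right)
  then have L2: "integrable (nu G) (\<lambda>x. w x * (f x)\<^sup>2)"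
    using c by simp
  have r: "\<rho> \<le> (if t \<in> {t1..<t2} then step_weight G w t1 t2 G1 G2 h t else 1)" for t
    unfolding \<rho>_def \<Delta>_def m_def using rho_le rho_le_one by auto
  have "dirichlet_form (target G w) (ideal_kernel G w) f = dirichlet_form (target G w) ideal.kernel f"
    and "dirichlet_form (target G w) (hybrid_kernel G w (step_kernel G w t1 t2 G1 G2 h)) f
      = dirichlet_form (target G w) hybrid.kernel f"
    by (intro dirichlet_form_cong; simp add: target_eq ideal_kernel_eq hybrid_kernel_eq)+
  with hybrid.dirichlet_form_bounds[OF f L2 c r] show ?thesis
    by (simp add: target_eq)
qed

end
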